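(* Let $Q\colon[0,1]^2\to[0,1]$ be a quasi-copula. The following conditions are equivalent: (i) There exist copulas $\{C_j\}_{j=1}^\infty$ and real numbers $\{\gamma_j\}_{j=1}^\infty$ such that $Q(x,y)=\sum_{j=1}^\infty\gamma_jC_j(x,y)$, where the series converges absolutely for all $x,y\in[0,1]$. (ii) $Q$ belongs to the linear span of the set of all copulas on $[0,1]^2$, i.e. there exist copulas $A$ and $B$ and real numbers $\alpha$ and $\beta$ such that $Q(x,y)=\alpha A(x,y)+\beta B(x,y)$ for all $x,y\in[0,1]$. (iii) $\alpha_Q<\infty$, where $$\alpha_Q=\sup_{n\ge1}\left\{\max_{i=1,\ldots,2^n}2^n\sum_{j=1}^{2^n}V_Q(R_{ij}^n)^+\,,\ \max_{j=1,\ldots,2^n}2^n\sum_{i=1}^{2^n}V_Q(R_{ij}^n)^+\right\},\qquad R_{ij}^n=\left[\tfrac{i-1}{2^n},\tfrac{i}{2^n}\right]\times\left[\tfrac{j-1}{2^n},\tfrac{j}{2^n}\right].$$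
   Context: A quasi-copula is a function $Q\colon[0,1]^2\to[0,1]$ such that: (a) $Q(x,0)=Q(0,y)=0$ for all $x,y\in[0,1]$; (b) $Q(x,1)=x$ and $Q(1,y)=y$ for all $x,y\in[0,1]$; (c) $Q$ is increasing (i.e. nondecreasing) in each of its arguments; (d) $|Q(x_2,y_2)-Q(x_1,y_1)|\le|x_2-x_1|+|y_2-y_1|$ for all $(x_1,y_1),(x_2,y_2)\in[0,1]^2$. A copula is a function $C\colon[0,1]^2\to[0,1]$ satisfying (a), (b) and $C(x_2,y_2)+C(x_1,y_1)-C(x_2,y_1)-C(x_1,y_2)\ge0$ whenever $0\le x_1\le x_2\le1$ and $0\le y_1\le y_2\le1$. For a rectangle $R=[x_1,x_2]\times[y_1,y_2]\subseteq[0,1]^2$, the $Q$-volume is $V_Q(R)=Q(x_2,y_2)-Q(x_1,y_2)-Q(x_2,y_1)+Q(x_1,y_1)$. For a real number $x$, $x^+=\max\{x,0\}$. The supremum defining $\alpha_Q$ is over all positive integers $n$ of the larger of the two displayed maxima, and takes values in $[0,\infty]$. *)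

theory Defs
  imports "HOL-Analysis.Analysis" "HOL-Library.Function_Algebras"
begin

text \<open>
  Functions on the unit square are represented by total functions of type
  \<open>real \<Rightarrow> real \<Rightarrow> real\<close>; nothing below depends on or constrains their values outside
  \<open>{0..1} \<times> {0..1}\<close>.
\<close>

definition volume :: "(real \<Rightarrow> real \<Rightarrow> real) \<Rightarrow> real \<Rightarrow> real \<Rightarrow> real \<Rightarrow> real \<Rightarrow> real" where
  "volume Q x1 x2 y1 y2 = Q x2 y2 - Q x1 y2 - Q x2 y1 + Q x1 y1"

definition quasi_copula :: "(real \<Rightarrow> real \<Rightarrow> real) \<Rightarrow> bool" where
  "quasi_copula Q \<longleftrightarrow>
     (\<forall>x\<in>{0..1}. \<forall>y\<in>{0..1}. Q x y \<in> {0..1}) \<and>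
     (\<forall>x\<in>{0..1}. Q x 0 = 0) \<and> (\<forall>y\<in>{0..1}. Q 0 y = 0) \<and>
     (\<forall>x\<in>{0..1}. Q x 1 = x) \<and> (\<forall>y\<in>{0..1}. Q 1 y = y) \<and>
     (\<forall>y\<in>{0..1}. mono_on {0..1} (\<lambda>x. Q x y)) \<and>
     (\<forall>x\<in>{0..1}. mono_on {0..1} (\<lambda>y. Q x y)) \<and>
     (\<forall>x1\<in>{0..1}. \<forall>y1\<in>{0..1}. \<forall>x2\<in>{0..1}. \<forall>y2\<in>{0..1}.
        \<bar>Q x2 y2 - Q x1 y1\<bar> \<le> \<bar>x2 - x1\<bar> + \<bar>y2 - y1\<bar>)"

definition copula :: "(real \<Rightarrow> real \<Rightarrow> real) \<Rightarrow> bool" where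
  "copula C \<longleftrightarrow>
     (\<forall>x\<in>{0..1}. \<forall>y\<in>{0..1}. C x y \<in> {0..1}) \<and>
     (\<forall>x\<in>{0..1}. C x 0 = 0) \<and> (\<forall>y\<in>{0..1}. C 0 y = 0) \<and>
     (\<forall>x\<in>{0..1}. C x 1 = x) \<and> (\<forall>y\<in>{0..1}. C 1 y = y) \<and>
     (\<forall>x1 x2 y1 y2. 0 \<le> x1 \<and> x1 \<le> x2 \<and> x2 \<le> 1 \<and> 0 \<le> y1 \<and> y1 \<le> y2 \<and> y2 \<le> 1 \<longrightarrow>
        C x2 y2 + C x1 y1 - C x2 y1 - C x1 y2 \<ge> 0)"

text \<open>The series is indexed from 0 instead of 1.\<close>

definition copula_series :: "(real \<Rightarrow> real \<Rightarrow> real) \<Rightarrow> bool" where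
  "copula_series Q \<longleftrightarrow>
     (\<exists>(C :: nat \<Rightarrow> real \<Rightarrow> real \<Rightarrow> real) (\<gamma> :: nat \<Rightarrow> real). (\<forall>j. copula (C j)) \<and>
        (\<forall>x\<in>{0..1}. \<forall>y\<in>{0..1}.
           summable (\<lambda>j. \<bar>\<gamma> j * C j x y\<bar>) \<and> Q x y = (\<Sum>j. \<gamma> j * C j x y)))"

text \<open>
  The span is taken in the vector space of all functions \<open>real \<Rightarrow> real \<Rightarrow> real\<close> with pointwise
  operations. Membership is up to equality on the unit square, which is the same as membership
  in the span of the restrictions of copulas to the unit square.
\<close>

definition in_copula_span :: "(real \<Rightarrow> real \<Rightarrow> real) \<Rightarrow> bool" where
  "in_copula_span Q \<longleftrightarrow>
     (\<exists>F \<in> module.span (\<lambda>c f x y. c * f x y) {C. copula C}.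
        \<forall>x\<in>{0..1}. \<forall>y\<in>{0..1}. Q x y = F x y)"

definition two_copula_combination :: "(real \<Rightarrow> real \<Rightarrow> real) \<Rightarrow> bool" where
  "two_copula_combination Q \<longleftrightarrow>
     (\<exists>A B (\<alpha> :: real) (\<beta> :: real). copula A \<and> copula B \<and>
        (\<forall>x\<in>{0..1}. \<forall>y\<in>{0..1}. Q x y = \<alpha> * A x y + \<beta> * B x y))"

definition dyadic_volume :: "(real \<Rightarrow> real \<Rightarrow> real) \<Rightarrow> nat \<Rightarrow> nat \<Rightarrow> nat \<Rightarrow> real" where
  "dyadic_volume Q n i j =
     volume Q ((real i - 1) / 2 ^ n) (real i / 2 ^ n) ((real j - 1) / 2 ^ n) (real j / 2 ^ n)"

definition alpha :: "(real \<Rightarrow> real \<Rightarrow> real) \<Rightarrow> ereal" where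
  "alpha Q = (SUP n\<in>{1::nat..}. ereal (max
     (MAX i\<in>{1..2 ^ n}. 2 ^ n * (\<Sum>j=1..2 ^ n. max (dyadic_volume Q n i j) 0))
     (MAX j\<in>{1..2 ^ n}. 2 ^ n * (\<Sum>i=1..2 ^ n. max (dyadic_volume Q n i j) 0))))"

text \<open>
  Interpreting this gives access to the library facts about the span in \<^const>\<open>in_copula_span\<close>.
\<close>

lemma vector_space_binary_functions:
  "vector_space (\<lambda>(c :: real) (f :: real \<Rightarrow> real \<Rightarrow> real) x y. c * f x y)"
  by unfold_locales (auto simp: fun_eq_iff algebra_simps)

end

theory Submission
  imports Defs
begin

text \<open>
  Everything is reduced to writing \<open>Q\<close> on the unit square as a difference of two functions that
  are nonnegative multiples of copulas (\<open>scaled_copula\<close>). Such functions are closed under sums,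
  nonnegative scaling and pointwise convergent series, so splitting coefficients into positive
  and negative parts turns a finite or absolutely convergent combination of copulas into such a
  difference, and hence into a combination of just two copulas.

  The number \<open>alpha Q\<close> is finite when \<open>Q = \<alpha>A + \<beta>B\<close>, because the volumes of a copula over the
  dyadic squares in a strip of width \<open>2\<^sup>-\<^sup>n\<close> add up to \<open>2\<^sup>-\<^sup>n\<close>, so that the scaled sums of positive parts are at most
  \<open>\<bar>\<alpha>\<bar> + \<bar>\<beta>\<bar>\<close>.

  For the converse, \<open>Q\<close> is treated like the distribution function of a signed measure with a
  Jordan decomposition. Let \<open>F\<^sub>n(x,y)\<close> be the sum of the positive parts of the volumes of the dyadic
  squares of level \<open>n\<close> that are contained in \<open>[0,x] \<times> [0,y]\<close>. Refining the grid can only increase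
  this number, whether or not \<open>x\<close> and \<open>y\<close> are dyadic, so \<open>F\<^sub>n\<close> increases to a limit \<open>F\<close> on the
  whole square.
  Both \<open>F\<close> and \<open>F - Q\<close> are 2-increasing as limits of sums of nonnegative masses, and finiteness of
  \<open>alpha Q\<close> makes \<open>F\<close> finite and its margins Lipschitz. Their defects
  \<open>c x - F(x,1)\<close> and \<open>c y - F(1,y)\<close> are therefore nondecreasing for large \<open>c\<close>, and adding a multiple
  of the product of the defects to both \<open>F\<close> and \<open>F - Q\<close> makes all margins linear.
\<close>

section \<open>Multiples of copulas\<close>

definition two_increasing :: "(real \<Rightarrow> real \<Rightarrow> real) \<Rightarrow> bool" where
  "two_increasing F \<longleftrightarrow>
     (\<forall>x1 x2 y1 y2. 0 \<le> x1 \<and> x1 \<le> x2 \<and> x2 \<le> 1 \<and> 0 \<le> y1 \<and> y1 \<le> y2 \<and> y2 \<le> 1 \<longrightarrow>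
        0 \<le> volume F x1 x2 y1 y2)"

lemma two_increasingI:
  assumes "\<And>x1 x2 y1 y2. \<lbrakk>0 \<le> x1; x1 \<le> x2; x2 \<le> 1; 0 \<le> y1; y1 \<le> y2; y2 \<le> 1\<rbrakk>
             \<Longrightarrow> 0 \<le> volume F x1 x2 y1 y2"
  shows "two_increasing F"
  using assms by (auto simp: two_increasing_def)

lemma two_increasingD:
  assumes "two_increasing F" "0 \<le> x1" "x1 \<le> x2" "x2 \<le> 1" "0 \<le> y1" "y1 \<le> y2" "y2 \<le> 1"
  shows "0 \<le> volume F x1 x2 y1 y2"
  using assms by (auto simp: two_increasing_def)

lemma two_increasing_add:
  assumes "two_increasing F" "two_increasing G"
  shows "two_increasing (\<lambda>x y. F x y + G x y)"
proof -
  have "volume (\<lambda>x y. F x y + G x y) x1 x2 y1 y2 = volume F x1 x2 y1 y2 + volume G x1 x2 y1 y2"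
    for x1 x2 y1 y2 by (simp add: volume_def)
  then show ?thesis
    using assms by (auto simp: two_increasing_def)
qed

text \<open>
  The linear margins with slope \<open>c\<close> are kept in place of a normalisation, which would have to
  exclude \<open>c = 0\<close> and would break closure under addition.
\<close>

definition scaled_copula :: "real \<Rightarrow> (real \<Rightarrow> real \<Rightarrow> real) \<Rightarrow> bool" where
  "scaled_copula c F \<longleftrightarrow>
     (\<forall>x\<in>{0..1}. F x 0 = 0 \<and> F x 1 = c * x) \<and>
     (\<forall>y\<in>{0..1}. F 0 y = 0 \<and> F 1 y = c * y) \<and> two_increasing F"

lemma scaled_copula_bounds:
  assumes "scaled_copula c F" "x \<in> {0..1}" "y \<in> {0..1}"
  shows "0 \<le> F x y" "F x y \<le> c * x"
  using two_increasingD[of F 0 x 0 y] two_increasingD[of F 0 x y 1] assms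
  by (auto simp: scaled_copula_def volume_def)

lemma copula_iff_scaled_copula: "copula C \<longleftrightarrow> scaled_copula 1 C"
proof
  assume "copula C"
  then show "scaled_copula 1 C"
    unfolding copula_def scaled_copula_def two_increasing_def volume_def
    by (auto simp: algebra_simps)
next
  assume C: "scaled_copula 1 C"
  then have "C x y \<in> {0..1}" if "x \<in> {0..1}" "y \<in> {0..1}" for x y
    using scaled_copula_bounds[OF C that] that by auto
  then show "copula C"
    using C unfolding copula_def scaled_copula_def two_increasing_def volume_def
    by (auto simp: algebra_simps)
qed

lemma scaled_copula_nonneg: "scaled_copula c F \<Longrightarrow> 0 \<le> c"
  using scaled_copula_bounds[of c F 1 1] by auto

lemma scaled_copula_add:
  assumes "scaled_copula a F" "scaled_copula b G"
  shows "scaled_copula (a + b) (\<lambda>x y. F x y + G x y)"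
  using assms by (auto simp: scaled_copula_def algebra_simps intro: two_increasing_add)

lemma scaled_copula_scale:
  assumes "scaled_copula a F" "0 \<le> c"
  shows "scaled_copula (c * a) (\<lambda>x y. c * F x y)"
proof -
  have "volume (\<lambda>x y. c * F x y) x1 x2 y1 y2 = c * volume F x1 x2 y1 y2"
    for x1 x2 y1 y2 by (simp add: volume_def algebra_simps)
  then show ?thesis
    using assms by (auto simp: scaled_copula_def two_increasing_def algebra_simps)
qed

lemma two_increasing_product_form:
  assumes "mono_on {0..1} f" "mono_on {0..1} g"
  shows "two_increasing (\<lambda>x y. f x * g y)"
proof (rule two_increasingI)
  fix x1 x2 y1 y2 :: real
  assume *: "0 \<le> x1" "x1 \<le> x2" "x2 \<le> 1" "0 \<le> y1" "y1 \<le> y2" "y2 \<le> 1"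
  have "volume (\<lambda>x y. f x * g y) x1 x2 y1 y2 = (f x2 - f x1) * (g y2 - g y1)"
    by (simp add: volume_def algebra_simps)
  moreover have "f x1 \<le> f x2" "g y1 \<le> g y2"
    using * assms by (auto intro: mono_onD)
  ultimately show "0 \<le> volume (\<lambda>x y. f x * g y) x1 x2 y1 y2" by simp
qed

lemma two_increasing_limit:
  assumes "\<And>n. two_increasing (F n)"
    and lim: "\<And>x y. \<lbrakk>x \<in> {0..1}; y \<in> {0..1}\<rbrakk> \<Longrightarrow> (\<lambda>n. F n x y) \<longlonglongrightarrow> G x y"
  shows "two_increasing G"
proof (rule two_increasingI)
  fix x1 x2 y1 y2 :: real
  assume *: "0 \<le> x1" "x1 \<le> x2" "x2 \<le> 1" "0 \<le> y1" "y1 \<le> y2" "y2 \<le> 1"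
  have "(\<lambda>n. volume (F n) x1 x2 y1 y2) \<longlonglongrightarrow> volume G x1 x2 y1 y2"
    unfolding volume_def using * by (intro tendsto_intros lim) auto
  moreover have "0 \<le> volume (F n) x1 x2 y1 y2" for n
    using two_increasingD[OF assms(1)] * by blast
  ultimately show "0 \<le> volume G x1 x2 y1 y2"
    by (intro LIMSEQ_le_const) auto
qed

lemma scaled_copula_limit:
  assumes F: "\<And>n. scaled_copula (a n) (F n)" and a: "a \<longlonglongrightarrow> c"
    and lim: "\<And>x y. \<lbrakk>x \<in> {0..1}; y \<in> {0..1}\<rbrakk> \<Longrightarrow> (\<lambda>n. F n x y) \<longlonglongrightarrow> G x y"
  shows "scaled_copula c G"
proof -
  have "two_increasing (F n)" for n using F[of n] by (simp add: scaled_copula_def)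
  then have "two_increasing G" using lim by (rule two_increasing_limit)
  moreover have "G x 0 = 0 \<and> G x 1 = c * x \<and> G 0 x = 0 \<and> G 1 x = c * x" if "x \<in> {0..1}" for x
  proof -
    have "(\<lambda>n. 0) \<longlonglongrightarrow> G x 0" "(\<lambda>n. a n * x) \<longlonglongrightarrow> G x 1" "(\<lambda>n. 0) \<longlonglongrightarrow> G 0 x" "(\<lambda>n. a n * x) \<longlonglongrightarrow> G 1 x"
      using lim[of x 0] lim[of x 1] lim[of 0 x] lim[of 1 x] F that
      by (simp_all add: scaled_copula_def)
    moreover have "(\<lambda>n. a n * x) \<longlonglongrightarrow> c * x" by (intro tendsto_intros a)
    ultimately show ?thesis
      using LIMSEQ_unique LIMSEQ_const_iff by metis
  qed
  ultimately show ?thesis by (auto simp: scaled_copula_def)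
qed

lemma scaled_copula_zero: "scaled_copula 0 (\<lambda>x y. 0)"
  by (simp add: scaled_copula_def two_increasing_def volume_def)

lemma scaled_copula_sum:
  assumes "\<And>j. scaled_copula (a j) (F j)"
  shows "scaled_copula (\<Sum>j<(n::nat). a j) (\<lambda>x y. \<Sum>j<n. F j x y)"
  using assms by (induction n) (auto intro: scaled_copula_zero scaled_copula_add)

lemma product_copula: "copula (\<lambda>x y. x * y)"
  using two_increasing_product_form[of "\<lambda>x. x" "\<lambda>y. y"]
  by (auto simp: copula_iff_scaled_copula scaled_copula_def mono_on_def)

text \<open>
  For \<open>c = 0\<close> the function vanishes on the square and any copula serves.
\<close>

lemma scaled_copula_obtains_copula:
  assumes F: "scaled_copula c F"
  obtains A where "copula A" "\<And>x y. \<lbrakk>x \<in> {0..1}; y \<in> {0..1}\<rbrakk> \<Longrightarrow> F x y = c * A x y"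
proof (cases "c = 0")
  case True
  then have "F x y = 0 * (x * y)" if "x \<in> {0..1}" "y \<in> {0..1}" for x y
    using scaled_copula_bounds[OF F that] by simp
  with that product_copula True show ?thesis by blast
next
  case False
  with scaled_copula_nonneg[OF F] have "copula (\<lambda>x y. (1 / c) * F x y)"
    using scaled_copula_scale[OF F, of "1 / c"] by (simp add: copula_iff_scaled_copula)
  with False show ?thesis by (intro that[of "\<lambda>x y. (1 / c) * F x y"]) auto
qed

section \<open>Linear combinations and series of copulas\<close>

definition scaled_copula_difference :: "(real \<Rightarrow> real \<Rightarrow> real) \<Rightarrow> bool" where
  "scaled_copula_difference Q \<longleftrightarrow>
     (\<exists>a b F G. scaled_copula a F \<and> scaled_copula b G \<and>
        (\<forall>x\<in>{0..1}. \<forall>y\<in>{0..1}. Q x y = F x y - G x y))"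

lemma scaled_copula_differenceI:
  assumes "scaled_copula a F" "scaled_copula b G"
    and "\<And>x y. \<lbrakk>x \<in> {0..1}; y \<in> {0..1}\<rbrakk> \<Longrightarrow> Q x y = F x y - G x y"
  shows "scaled_copula_difference Q"
  using assms unfolding scaled_copula_difference_def by blast

lemma two_copula_combination_if_difference:
  assumes "scaled_copula_difference Q"
  shows "two_copula_combination Q"
proof -
  obtain a b F G where FG: "scaled_copula a F" "scaled_copula b G"
    and Q: "\<forall>x\<in>{0..1}. \<forall>y\<in>{0..1}. Q x y = F x y - G x y"
    using assms unfolding scaled_copula_difference_def by blast
  obtain A where A: "copula A" "\<And>x y. \<lbrakk>x \<in> {0..1}; y \<in> {0..1}\<rbrakk> \<Longrightarrow> F x y = a * A x y"
    using scaled_copula_obtains_copula[OF FG(1)] by blast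
  obtain B where B: "copula B" "\<And>x y. \<lbrakk>x \<in> {0..1}; y \<in> {0..1}\<rbrakk> \<Longrightarrow> G x y = b * B x y"
    using scaled_copula_obtains_copula[OF FG(2)] by blast
  have "\<forall>x\<in>{0..1}. \<forall>y\<in>{0..1}. Q x y = a * A x y + (- b) * B x y"
    using Q A(2) B(2) by simp
  with A(1) B(1) show ?thesis unfolding two_copula_combination_def by blast
qed

lemma difference_if_in_copula_span:
  assumes "in_copula_span Q"
  shows "scaled_copula_difference Q"
proof -
  interpret V: vector_space "\<lambda>(c :: real) (f :: real \<Rightarrow> real \<Rightarrow> real) x y. c * f x y"
    by (rule vector_space_binary_functions)
  obtain S where S: "S \<in> V.span {C. copula C}"
    and Q: "\<forall>x\<in>{0..1}. \<forall>y\<in>{0..1}. Q x y = S x y"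
    using assms unfolding in_copula_span_def by blast
  have "scaled_copula_difference S"
    using S
  proof (induction rule: V.span_induct_alt)
    case base
    show ?case
      by (rule scaled_copula_differenceI[OF scaled_copula_zero scaled_copula_zero])
        (simp add: zero_fun_def)
  next
    case (step c C T)
    then obtain a b F G where FG: "scaled_copula a F" "scaled_copula b G"
      and T: "\<forall>x\<in>{0..1}. \<forall>y\<in>{0..1}. T x y = F x y - G x y"
      unfolding scaled_copula_difference_def by blast
    from step have C: "scaled_copula 1 C" by (simp add: copula_iff_scaled_copula)
    note part = scaled_copula_scale[OF C, of "max c 0"] scaled_copula_scale[OF C, of "max (- c) 0"]
    have "c = max c 0 - max (- c) 0" by simp
    then have "c * C x y = max c 0 * C x y - max (- c) 0 * C x y" for x y
      by (metis left_diff_distrib)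
    with T show ?case
      by (intro scaled_copula_differenceI[OF scaled_copula_add[OF part(1) FG(1)]
            scaled_copula_add[OF part(2) FG(2)]]) (auto simp: plus_fun_def)
  qed
  with Q show ?thesis
    unfolding scaled_copula_difference_def by simp
qed

text \<open>
  Absolute convergence allows the series to be split by the sign of the coefficients. At \<open>(1,1)\<close>,
  where every copula equals \<open>1\<close>, it says that the coefficients themselves are absolutely summable, so
  the slopes of the two resulting functions are finite.
\<close>

lemma difference_if_copula_series:
  assumes "copula_series Q"
  shows "scaled_copula_difference Q"
proof -
  obtain C :: "nat \<Rightarrow> real \<Rightarrow> real \<Rightarrow> real" and \<gamma> where C': "\<forall>j. copula (C j)"
    and series: "\<forall>x\<in>{0..1}. \<forall>y\<in>{0..1}.
      summable (\<lambda>j. \<bar>\<gamma> j * C j x y\<bar>) \<and> Q x y = (\<Sum>j. \<gamma> j * C j x y)"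
    using assms unfolding copula_series_def by (elim exE conjE)
  have C: "copula (C j)" for j using C' ..
  have abs: "summable (\<lambda>j. \<bar>\<gamma> j * C j x y\<bar>)" and Q: "Q x y = (\<Sum>j. \<gamma> j * C j x y)"
    if "x \<in> {0..1}" "y \<in> {0..1}" for x y using series that by blast+
  have part: "summable (\<lambda>j. d j * C j x y)"
    if "\<And>j. \<bar>d j\<bar> \<le> \<bar>\<gamma> j\<bar>" "x \<in> {0..1}" "y \<in> {0..1}" for d x y
    using that by (intro summable_comparison_test'[OF abs[OF that(2,3)], of 0])
      (auto simp: abs_mult intro: mult_right_mono)
  have scaled: "scaled_copula (\<Sum>j. d j) (\<lambda>x y. \<Sum>j. d j * C j x y)"
    if d: "\<And>j. \<bar>d j\<bar> \<le> \<bar>\<gamma> j\<bar>" "\<And>j. 0 \<le> d j" for d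
  proof (rule scaled_copula_limit)
    show "scaled_copula (\<Sum>j<n. d j) (\<lambda>x y. \<Sum>j<n. d j * C j x y)" for n
      using scaled_copula_scale[of 1 "C j" "d j" for j] C d(2)
      by (intro scaled_copula_sum) (simp add: copula_iff_scaled_copula)
    have "C j 1 1 = 1" for j
      using C[of j] by (simp add: copula_def)
    with part[of d 1 1] d show "(\<lambda>n. \<Sum>j<n. d j) \<longlonglongrightarrow> (\<Sum>j. d j)"
      by (intro summable_LIMSEQ) simp
    show "(\<lambda>n. \<Sum>j<n. d j * C j x y) \<longlonglongrightarrow> (\<Sum>j. d j * C j x y)"
      if "x \<in> {0..1}" "y \<in> {0..1}" for x y
      using part[of d] d that by (intro summable_LIMSEQ) auto
  qed
  show ?thesis
  proof (rule scaled_copula_differenceI)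
    show "scaled_copula (\<Sum>j. max (\<gamma> j) 0) (\<lambda>x y. \<Sum>j. max (\<gamma> j) 0 * C j x y)"
      by (rule scaled) auto
    show "scaled_copula (\<Sum>j. max (- \<gamma> j) 0) (\<lambda>x y. \<Sum>j. max (- \<gamma> j) 0 * C j x y)"
      by (rule scaled) auto
    fix x y :: real assume xy: "x \<in> {0..1}" "y \<in> {0..1}"
    have "\<gamma> j = max (\<gamma> j) 0 - max (- \<gamma> j) 0" for j by simp
    then have "\<gamma> j * C j x y = max (\<gamma> j) 0 * C j x y - max (- \<gamma> j) 0 * C j x y" for j
      by (metis left_diff_distrib)
    with Q[OF xy] show "Q x y = (\<Sum>j. max (\<gamma> j) 0 * C j x y) - (\<Sum>j. max (- \<gamma> j) 0 * C j x y)"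
      using part[of "\<lambda>j. max (\<gamma> j) 0" x y] part[of "\<lambda>j. max (- \<gamma> j) 0" x y] xy
      by (subst suminf_diff) auto
  qed
qed

lemma in_copula_span_if_two:
  assumes "two_copula_combination Q"
  shows "in_copula_span Q"
proof -
  interpret V: vector_space "\<lambda>(c :: real) (f :: real \<Rightarrow> real \<Rightarrow> real) x y. c * f x y"
    by (rule vector_space_binary_functions)
  obtain A B \<alpha> \<beta> where AB: "copula A" "copula B"
    and Q: "\<forall>x\<in>{0..1}. \<forall>y\<in>{0..1}. Q x y = \<alpha> * A x y + \<beta> * B x y"
    using assms unfolding two_copula_combination_def by blast
  have "(\<lambda>x y. \<alpha> * A x y) + (\<lambda>x y. \<beta> * B x y) \<in> V.span {C. copula C}"
    using AB by (intro V.span_add V.span_scale V.span_base) auto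
  with Q show ?thesis
    unfolding in_copula_span_def by (intro bexI) (auto simp: plus_fun_def)
qed

lemma copula_series_if_two:
  assumes "two_copula_combination Q"
  shows "copula_series Q"
proof -
  obtain A B \<alpha> \<beta> where AB: "copula A" "copula B"
    and Q: "\<forall>x\<in>{0..1}. \<forall>y\<in>{0..1}. Q x y = \<alpha> * A x y + \<beta> * B x y"
    using assms unfolding two_copula_combination_def by blast
  define C where "C j = (if j = 0 then A else B)" for j :: nat
  define \<gamma> where "\<gamma> j = (if j = 0 then \<alpha> else if j = 1 then \<beta> else 0)" for j :: nat
  have "summable (\<lambda>j. \<bar>\<gamma> j * C j x y\<bar>)" for x y
    by (rule summable_finite[of "{0, 1}"]) (auto simp: \<gamma>_def)
  moreover have "(\<Sum>j. \<gamma> j * C j x y) = \<alpha> * A x y + \<beta> * B x y" for x y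
    by (subst suminf_finite[of "{0, 1}"]) (auto simp: \<gamma>_def C_def)
  moreover have "copula (C j)" for j using AB by (simp add: C_def)
  ultimately show ?thesis using Q unfolding copula_series_def by metis
qed

section \<open>Dyadic sums of positive parts\<close>

lemma alpha_finite_iff:
  "alpha Q < \<infinity> \<longleftrightarrow>
     (\<exists>K. \<forall>n\<ge>1. \<forall>k\<in>{1..2 ^ n}.
        2 ^ n * (\<Sum>j=1..2 ^ n. max (dyadic_volume Q n k j) 0) \<le> K \<and>
        2 ^ n * (\<Sum>i=1..2 ^ n. max (dyadic_volume Q n i k) 0) \<le> K)"
    (is "_ \<longleftrightarrow> (\<exists>K. \<forall>n\<ge>1. \<forall>k\<in>_. ?r n k \<le> K \<and> ?c n k \<le> K)")
proof -
  define m where "m n = max (MAX k\<in>{1..2 ^ n}. ?r n k) (MAX k\<in>{1..2 ^ n}. ?c n k)" for n :: nat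
  have m: "m n \<le> K \<longleftrightarrow> (\<forall>k\<in>{1..2 ^ n}. ?r n k \<le> K \<and> ?c n k \<le> K)" for n K
  proof -
    have "{1..(2::nat) ^ n} \<noteq> {}" by simp
    then show ?thesis unfolding m_def by (auto simp: Max_le_iff)
  qed
  have alpha: "alpha Q = (SUP n\<in>{1..}. ereal (m n))"
    unfolding alpha_def m_def ..
  have "alpha Q < \<infinity> \<longleftrightarrow> (\<exists>K. \<forall>n\<ge>1. m n \<le> K)"
  proof
    assume fin: "alpha Q < \<infinity>"
    have le: "ereal (m n) \<le> alpha Q" if "n \<ge> 1" for n
      using that unfolding alpha by (intro SUP_upper) auto
    with fin obtain K where "alpha Q = ereal K"
      by (cases "alpha Q") (use le[of 1] in auto)
    with le show "\<exists>K. \<forall>n\<ge>1. m n \<le> K" by auto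
  next
    assume "\<exists>K. \<forall>n\<ge>1. m n \<le> K"
    then obtain K where "\<forall>n\<ge>1. m n \<le> K" ..
    then have "alpha Q \<le> ereal K"
      unfolding alpha by (intro SUP_least) auto
    then show "alpha Q < \<infinity>" by (auto intro: le_less_trans)
  qed
  then show ?thesis by (simp only: m)
qed

lemma dyadic_endpoints_in_unit:
  assumes "k \<in> {1..2 ^ n}"
  shows "(real k - 1) / 2 ^ n \<in> {0..1}" "real k / 2 ^ n \<in> {0..1}"
proof -
  have "1 \<le> real k" "real k \<le> 2 ^ n"
    using assms by (auto simp flip: of_nat_le_iff)
  moreover have "(t - 1) / 2 ^ n \<in> {0..1}" "t / 2 ^ n \<in> {0..1}" if "1 \<le> t" "t \<le> 2 ^ n" for t :: real
    using that by (auto simp: divide_le_eq_1)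
  ultimately show "(real k - 1) / 2 ^ n \<in> {0..1}" "real k / 2 ^ n \<in> {0..1}" by blast+
qed

lemma sum_dyadic_volume_row:
  assumes "\<And>x. x \<in> {0..1} \<Longrightarrow> F x 0 = 0" "i \<in> {1..2 ^ n}"
  shows "(\<Sum>j=1..b. dyadic_volume F n i j) =
           F (real i / 2 ^ n) (real b / 2 ^ n) - F ((real i - 1) / 2 ^ n) (real b / 2 ^ n)"
proof (induction b)
  case 0
  show ?case using assms(1) dyadic_endpoints_in_unit[OF assms(2)] by simp
next
  case (Suc b)
  then show ?case by (simp add: dyadic_volume_def volume_def)
qed

lemma sum_dyadic_volume:
  assumes "\<And>x. x \<in> {0..1} \<Longrightarrow> F x 0 = 0" "\<And>y. y \<in> {0..1} \<Longrightarrow> F 0 y = 0"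
    and "a \<le> 2 ^ n" "b \<le> 2 ^ n"
  shows "(\<Sum>i=1..a. \<Sum>j=1..b. dyadic_volume F n i j) = F (real a / 2 ^ n) (real b / 2 ^ n)"
  using assms(3)
proof (induction a)
  case 0
  have "real b \<le> 2 ^ n" using assms(4) by (simp flip: of_nat_le_iff)
  then show ?case using assms by simp
next
  case (Suc a)
  have "(\<Sum>j=1..b. dyadic_volume F n (Suc a) j) =
      F (real (Suc a) / 2 ^ n) (real b / 2 ^ n) - F ((real (Suc a) - 1) / 2 ^ n) (real b / 2 ^ n)"
    using Suc.prems by (intro sum_dyadic_volume_row assms(1)) auto
  with Suc show ?case by simp
qed

lemma copula_dyadic_volume:
  assumes C: "copula C" and n: "i \<in> {1..2 ^ n}"
  shows "j \<in> {1..2 ^ n} \<Longrightarrow> 0 \<le> dyadic_volume C n i j"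
    and "(\<Sum>j=1..2 ^ n. dyadic_volume C n i j) = 1 / 2 ^ n"
    and "(\<Sum>j=1..2 ^ n. dyadic_volume C n j i) = 1 / 2 ^ n"
proof -
  show "0 \<le> dyadic_volume C n i j" if "j \<in> {1..2 ^ n}"
    using C dyadic_endpoints_in_unit[OF n] dyadic_endpoints_in_unit[OF that]
    unfolding copula_iff_scaled_copula scaled_copula_def dyadic_volume_def
    by (intro two_increasingD) (auto simp: divide_right_mono)
  have one: "(\<Sum>j=1..2 ^ n. dyadic_volume F n i j) = 1 / 2 ^ n"
    if "\<And>x. x \<in> {0..1} \<Longrightarrow> F x 0 = 0" "\<And>x. x \<in> {0..1} \<Longrightarrow> F x 1 = x" for F
    using sum_dyadic_volume_row[of F, OF that(1) n, of "2 ^ n"] dyadic_endpoints_in_unit[OF n]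
    by (simp add: that(2) diff_divide_distrib)
  show "(\<Sum>j=1..2 ^ n. dyadic_volume C n i j) = 1 / 2 ^ n"
    using C by (intro one) (auto simp: copula_def)
  show "(\<Sum>j=1..2 ^ n. dyadic_volume C n j i) = 1 / 2 ^ n"
    using C one[of "\<lambda>x y. C y x"]
    by (simp add: copula_def dyadic_volume_def volume_def algebra_simps)
qed

lemma alpha_finite_if_two:
  assumes "two_copula_combination Q"
  shows "alpha Q < \<infinity>"
proof -
  obtain A B \<alpha> \<beta> where AB: "copula A" "copula B"
    and Q: "\<And>x y. \<lbrakk>x \<in> {0..1}; y \<in> {0..1}\<rbrakk> \<Longrightarrow> Q x y = \<alpha> * A x y + \<beta> * B x y"
    using assms unfolding two_copula_combination_def by blast
  have le: "max (dyadic_volume Q n i j) 0 \<le>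
              \<bar>\<alpha>\<bar> * dyadic_volume A n i j + \<bar>\<beta>\<bar> * dyadic_volume B n i j"
    if ij: "i \<in> {1..2 ^ n}" "j \<in> {1..2 ^ n}" for n i j
  proof -
    have "dyadic_volume Q n i j = \<alpha> * dyadic_volume A n i j + \<beta> * dyadic_volume B n i j"
      using dyadic_endpoints_in_unit[OF ij(1)] dyadic_endpoints_in_unit[OF ij(2)]
      by (simp add: dyadic_volume_def volume_def Q algebra_simps)
    moreover have "0 \<le> dyadic_volume A n i j" "0 \<le> dyadic_volume B n i j"
      using copula_dyadic_volume(1) AB ij by blast+
    ultimately show ?thesis
      by (auto intro!: add_mono mult_right_mono)
  qed
  show ?thesis
    unfolding alpha_finite_iff
  proof (intro exI allI impI ballI conjI)
    fix n k :: nat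
    assume k: "k \<in> {1..2 ^ n}"
    have "(\<Sum>j=1..2 ^ n. max (dyadic_volume Q n k j) 0) \<le>
            (\<Sum>j=1..2 ^ n. \<bar>\<alpha>\<bar> * dyadic_volume A n k j + \<bar>\<beta>\<bar> * dyadic_volume B n k j)"
      using k by (intro sum_mono le) auto
    also have "\<dots> = (\<bar>\<alpha>\<bar> + \<bar>\<beta>\<bar>) / 2 ^ n"
      using copula_dyadic_volume(2)[OF AB(1) k] copula_dyadic_volume(2)[OF AB(2) k]
      by (simp add: sum.distrib add_divide_distrib flip: sum_distrib_left)
    finally show "2 ^ n * (\<Sum>j=1..2 ^ n. max (dyadic_volume Q n k j) 0) \<le> \<bar>\<alpha>\<bar> + \<bar>\<beta>\<bar>"
      by (simp add: field_simps)
    have "(\<Sum>i=1..2 ^ n. max (dyadic_volume Q n i k) 0) \<le>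
            (\<Sum>i=1..2 ^ n. \<bar>\<alpha>\<bar> * dyadic_volume A n i k + \<bar>\<beta>\<bar> * dyadic_volume B n i k)"
      using k by (intro sum_mono le) auto
    also have "\<dots> = (\<bar>\<alpha>\<bar> + \<bar>\<beta>\<bar>) / 2 ^ n"
      using copula_dyadic_volume(3)[OF AB(1) k] copula_dyadic_volume(3)[OF AB(2) k]
      by (simp add: sum.distrib add_divide_distrib flip: sum_distrib_left)
    finally show "2 ^ n * (\<Sum>i=1..2 ^ n. max (dyadic_volume Q n i k) 0) \<le> \<bar>\<alpha>\<bar> + \<bar>\<beta>\<bar>"
      by (simp add: field_simps)
  qed
qed

section \<open>The positive part of a quasi-copula\<close>

text \<open>
  The index of the last dyadic interval of level \<open>n\<close> that lies entirely in \<open>[0,x]\<close>, and \<open>0\<close>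
  if there is none.
\<close>

definition dyadic_index :: "nat \<Rightarrow> real \<Rightarrow> nat" where
  "dyadic_index n x = nat \<lfloor>2 ^ n * x\<rfloor>"

lemma dyadic_index_0 [simp]: "dyadic_index n 0 = 0"
  and dyadic_index_1 [simp]: "dyadic_index n 1 = 2 ^ n"
  by (simp_all add: dyadic_index_def nat_power_eq)

lemma dyadic_index_mono: "x \<le> y \<Longrightarrow> dyadic_index n x \<le> dyadic_index n y"
  by (auto simp: dyadic_index_def intro!: nat_mono floor_mono)

lemma dyadic_index_le: "x \<le> 1 \<Longrightarrow> dyadic_index n x \<le> 2 ^ n"
  using dyadic_index_mono[of x 1 n] by simp

lemma dyadic_index_Suc: "2 * dyadic_index n x \<le> dyadic_index (Suc n) x"
  unfolding dyadic_index_def by (simp add: le_nat_iff le_floor_iff) linarith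

lemma dyadic_index_approx:
  assumes "0 \<le> x"
  shows "\<bar>real (dyadic_index n x) / 2 ^ n - x\<bar> \<le> (1 / 2) ^ n"
proof -
  have "\<bar>real (dyadic_index n x) - 2 ^ n * x\<bar> \<le> 1"
    using assms unfolding dyadic_index_def by (simp add: of_nat_nat) linarith
  then have "\<bar>real (dyadic_index n x) - 2 ^ n * x\<bar> / 2 ^ n \<le> 1 / 2 ^ n"
    by (rule divide_right_mono) simp
  also have "\<bar>real (dyadic_index n x) - 2 ^ n * x\<bar> / 2 ^ n =
      \<bar>(real (dyadic_index n x) - 2 ^ n * x) / 2 ^ n\<bar>" by simp
  also have "(real (dyadic_index n x) - 2 ^ n * x) / 2 ^ n = real (dyadic_index n x) / 2 ^ n - x"
    by (simp add: diff_divide_distrib)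
  finally show ?thesis by (simp add: power_one_over)
qed

lemma dyadic_index_tendsto:
  assumes "0 \<le> x"
  shows "(\<lambda>n. real (dyadic_index n x) / 2 ^ n) \<longlonglongrightarrow> x"
proof (rule LIM_zero_cancel, rule Lim_null_comparison)
  show "(\<lambda>n. (1 / 2 :: real) ^ n) \<longlonglongrightarrow> 0" by (intro LIMSEQ_realpow_zero) auto
qed (use dyadic_index_approx[OF assms] in auto)

text \<open>
  The distribution function that puts mass \<open>w i j\<close> on the upper right corner of the dyadic
  square \<open>(i,j)\<close> of level \<open>n\<close>.
\<close>

definition dyadic_mass :: "(nat \<Rightarrow> nat \<Rightarrow> real) \<Rightarrow> nat \<Rightarrow> real \<Rightarrow> real \<Rightarrow> real" where
  "dyadic_mass w n x y = (\<Sum>i=1..dyadic_index n x. \<Sum>j=1..dyadic_index n y. w i j)"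

lemma sum_atLeastAtMost_1_diff:
  fixes f :: "nat \<Rightarrow> real"
  assumes "a \<le> b"
  shows "(\<Sum>i=1..b. f i) - (\<Sum>i=1..a. f i) = (\<Sum>i\<in>{a<..b}. f i)"
proof -
  have "{1..b} = {1..a} \<union> {a<..b}" using assms by auto
  then have "(\<Sum>i=1..b. f i) = (\<Sum>i=1..a. f i) + (\<Sum>i\<in>{a<..b}. f i)"
    by (simp add: sum.union_disjoint ivl_disj_int)
  then show ?thesis by simp
qed

lemma two_increasing_dyadic_mass:
  assumes "\<And>i j. \<lbrakk>i \<in> {1..2 ^ n}; j \<in> {1..2 ^ n}\<rbrakk> \<Longrightarrow> 0 \<le> w i j"
  shows "two_increasing (dyadic_mass w n)"
proof (rule two_increasingI)
  fix x1 x2 y1 y2 :: real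
  assume *: "0 \<le> x1" "x1 \<le> x2" "x2 \<le> 1" "0 \<le> y1" "y1 \<le> y2" "y2 \<le> 1"
  define a where "a = dyadic_index n"
  have a: "a x1 \<le> a x2" "a x2 \<le> 2 ^ n" "a y1 \<le> a y2" "a y2 \<le> 2 ^ n"
    using * unfolding a_def by (auto intro: dyadic_index_mono dyadic_index_le)
  have "volume (dyadic_mass w n) x1 x2 y1 y2 =
          (\<Sum>i=1..a x2. (\<Sum>j=1..a y2. w i j) - (\<Sum>j=1..a y1. w i j)) -
          (\<Sum>i=1..a x1. (\<Sum>j=1..a y2. w i j) - (\<Sum>j=1..a y1. w i j))"
    by (simp add: volume_def dyadic_mass_def a_def sum_subtractf)
  also have "\<dots> = (\<Sum>i\<in>{a x1<..a x2}. \<Sum>j\<in>{a y1<..a y2}. w i j)"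
    by (simp only: sum_atLeastAtMost_1_diff[OF a(1)] sum_atLeastAtMost_1_diff[OF a(3)])
  also have "0 \<le> \<dots>"
    using a by (intro sum_nonneg assms) auto
  finally show "0 \<le> volume (dyadic_mass w n) x1 x2 y1 y2" .
qed

definition positive_mass :: "(real \<Rightarrow> real \<Rightarrow> real) \<Rightarrow> nat \<Rightarrow> real \<Rightarrow> real \<Rightarrow> real" where
  "positive_mass Q n = dyadic_mass (\<lambda>i j. max (dyadic_volume Q n i j) 0) n"

lemma dyadic_volume_refine:
  assumes "1 \<le> i" "1 \<le> j"
  shows "dyadic_volume Q n i j =
    dyadic_volume Q (Suc n) (2 * i - 1) (2 * j - 1) + dyadic_volume Q (Suc n) (2 * i - 1) (2 * j) +
    (dyadic_volume Q (Suc n) (2 * i) (2 * j - 1) + dyadic_volume Q (Suc n) (2 * i) (2 * j))"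
proof -
  have "real (2 * k - 1) = 2 * real k - 1" if "1 \<le> k" for k using that by simp
  moreover have "(2 * x - 1 - 1) / (2 * 2 ^ n) = (x - 1) / 2 ^ n" for x :: real
    by (simp add: field_simps)
  ultimately show ?thesis
    using assms by (simp add: dyadic_volume_def volume_def)
qed

lemma sum_pairs:
  fixes f :: "nat \<Rightarrow> real"
  shows "(\<Sum>i=1..2 * a. f i) = (\<Sum>i=1..a. f (2 * i - 1) + f (2 * i))"
  by (induction a) auto

text \<open>
  The positive part is subadditive, so splitting a square into four does not decrease its
  contribution; moreover the finer squares may fill part of the gap that the coarser ones leave
  below \<open>x\<close> and \<open>y\<close>.
\<close>

lemma positive_mass_Suc: "positive_mass Q n x y \<le> positive_mass Q (Suc n) x y"
proof -
  define w where "w n i j = max (dyadic_volume Q n i j) 0" for n i j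
  have split4: "w n i j \<le> w (Suc n) (2 * i - 1) (2 * j - 1) + w (Suc n) (2 * i - 1) (2 * j) +
      (w (Suc n) (2 * i) (2 * j - 1) + w (Suc n) (2 * i) (2 * j))" if "1 \<le> i" "1 \<le> j" for i j
    unfolding w_def dyadic_volume_refine[OF that, of Q n] by (auto simp: max_def)
  let ?a = "dyadic_index n x" and ?b = "dyadic_index n y"
  have "positive_mass Q n x y = (\<Sum>i=1..?a. \<Sum>j=1..?b. w n i j)"
    by (simp add: positive_mass_def dyadic_mass_def w_def)
  also have "\<dots> \<le> (\<Sum>i=1..?a. \<Sum>j=1..?b.
      w (Suc n) (2 * i - 1) (2 * j - 1) + w (Suc n) (2 * i - 1) (2 * j) +
      (w (Suc n) (2 * i) (2 * j - 1) + w (Suc n) (2 * i) (2 * j)))"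
    by (intro sum_mono split4) auto
  also have "\<dots> = (\<Sum>i=1..2 * ?a. \<Sum>j=1..2 * ?b. w (Suc n) i j)"
    by (simp only: sum_pairs sum.distrib)
  also have "\<dots> \<le> (\<Sum>i=1..2 * ?a. \<Sum>j=1..dyadic_index (Suc n) y. w (Suc n) i j)"
    using dyadic_index_Suc[of n y] by (intro sum_mono sum_mono2) (auto simp: w_def)
  also have "\<dots> \<le> (\<Sum>i=1..dyadic_index (Suc n) x. \<Sum>j=1..dyadic_index (Suc n) y. w (Suc n) i j)"
    using dyadic_index_Suc[of n x] by (intro sum_mono2 sum_nonneg) (auto simp: w_def)
  also have "\<dots> = positive_mass Q (Suc n) x y"
    by (simp add: positive_mass_def dyadic_mass_def w_def)
  finally show ?thesis .
qed

text \<open>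
  The Lipschitz estimate for the margins at level \<open>n\<close>: here \<open>f\<close> is the mass of a row or a column, and
  the increment of the argument is rounded to the grid, which disappears in the limit.
\<close>

lemma dyadic_sum_increment_le:
  assumes "\<And>i. i \<in> {1..2 ^ n} \<Longrightarrow> 2 ^ n * f i \<le> K" "x1 \<le> x2" "x2 \<le> 1"
  shows "(\<Sum>i=1..dyadic_index n x2. f i) - (\<Sum>i=1..dyadic_index n x1. f i) \<le>
           K * (real (dyadic_index n x2) / 2 ^ n - real (dyadic_index n x1) / 2 ^ n)"
proof -
  have a: "dyadic_index n x1 \<le> dyadic_index n x2" "dyadic_index n x2 \<le> 2 ^ n"
    using assms by (auto intro: dyadic_index_mono dyadic_index_le)
  have "(\<Sum>i=1..dyadic_index n x2. f i) - (\<Sum>i=1..dyadic_index n x1. f i) =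
          (\<Sum>i\<in>{dyadic_index n x1<..dyadic_index n x2}. f i)"
    by (rule sum_atLeastAtMost_1_diff[OF a(1)])
  also have "\<dots> \<le> (\<Sum>i\<in>{dyadic_index n x1<..dyadic_index n x2}. K / 2 ^ n)"
    using a assms(1) by (intro sum_mono) (auto simp: field_simps)
  also have "\<dots> = K * (real (dyadic_index n x2) / 2 ^ n - real (dyadic_index n x1) / 2 ^ n)"
    using a by (simp add: of_nat_diff field_simps)
  finally show ?thesis .
qed

lemma quasi_copula_dyadic_index_tendsto:
  assumes Q: "quasi_copula Q" and xy: "x \<in> {0..1}" "y \<in> {0..1}"
  shows "(\<lambda>n. Q (real (dyadic_index n x) / 2 ^ n) (real (dyadic_index n y) / 2 ^ n)) \<longlonglongrightarrow> Q x y"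
proof (rule LIM_zero_cancel, rule Lim_null_comparison)
  let ?p = "\<lambda>n. real (dyadic_index n x) / 2 ^ n" and ?q = "\<lambda>n. real (dyadic_index n y) / 2 ^ n"
  have unit: "real (dyadic_index n z) / 2 ^ n \<in> {0..1}" if "z \<in> {0..1}" for n z
    using dyadic_index_le[of z n] that by (simp flip: of_nat_le_iff)
  show "\<forall>\<^sub>F n in sequentially. norm (Q (?p n) (?q n) - Q x y) \<le> \<bar>?p n - x\<bar> + \<bar>?q n - y\<bar>"
    using Q xy unit unfolding quasi_copula_def real_norm_def by (intro always_eventually allI) blast
  have "(\<lambda>n. \<bar>?p n - x\<bar> + \<bar>?q n - y\<bar>) \<longlonglongrightarrow> \<bar>x - x\<bar> + \<bar>y - y\<bar>"
    using xy by (intro tendsto_intros dyadic_index_tendsto) auto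
  then show "(\<lambda>n. \<bar>?p n - x\<bar> + \<bar>?q n - y\<bar>) \<longlonglongrightarrow> 0" by simp
qed

text \<open>
  \<open>F\<close> is the distribution function of the positive part of the signed measure induced by \<open>Q\<close>, and
  \<open>F - Q\<close> that of the negative part. The last two properties state that the margins of \<open>F\<close> grow with
  slope at most \<open>K\<close>, in the form in which they are needed to correct the margins.
\<close>

lemma quasi_copula_positive_part:
  assumes Q: "quasi_copula Q" and fin: "alpha Q < \<infinity>"
  obtains F K where "two_increasing F" "two_increasing (\<lambda>x y. F x y - Q x y)"
    "\<And>x. F x 0 = 0" "\<And>y. F 0 y = 0"
    "mono_on {0..1} (\<lambda>x. K * x - F x 1)" "mono_on {0..1} (\<lambda>y. K * y - F 1 y)"
proof -
  define P where "P = positive_mass Q"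
  define F where "F x y = lim (\<lambda>n. P n x y)" for x y
  obtain K where row: "\<And>n k. \<lbrakk>n \<ge> 1; k \<in> {1..2 ^ n}\<rbrakk> \<Longrightarrow>
        2 ^ n * (\<Sum>j=1..2 ^ n. max (dyadic_volume Q n k j) 0) \<le> K"
    and col: "\<And>n k. \<lbrakk>n \<ge> 1; k \<in> {1..2 ^ n}\<rbrakk> \<Longrightarrow>
        2 ^ n * (\<Sum>i=1..2 ^ n. max (dyadic_volume Q n i k) 0) \<le> K"
    using fin unfolding alpha_finite_iff by blast
  have P0: "P n x 0 = 0" "P n 0 y = 0" for n x y
    by (simp_all add: P_def positive_mass_def dyadic_mass_def)
  have P2: "two_increasing (P n)" for n
    unfolding P_def positive_mass_def by (rule two_increasing_dyadic_mass) simp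

  have incr1: "P n x2 1 - P n x1 1 \<le>
      K * (real (dyadic_index n x2) / 2 ^ n - real (dyadic_index n x1) / 2 ^ n)"
    if "n \<ge> 1" "x1 \<le> x2" "x2 \<le> 1" for n x1 x2
    using dyadic_sum_increment_le[OF row[OF that(1)] that(2,3)]
    by (simp add: P_def positive_mass_def dyadic_mass_def)
  have incr2: "P n 1 y2 - P n 1 y1 \<le>
      K * (real (dyadic_index n y2) / 2 ^ n - real (dyadic_index n y1) / 2 ^ n)"
    if "n \<ge> 1" "y1 \<le> y2" "y2 \<le> 1" for n y1 y2
  proof -
    have "P n 1 y = (\<Sum>j=1..dyadic_index n y. \<Sum>i=1..2 ^ n. max (dyadic_volume Q n i j) 0)" for y
      unfolding P_def positive_mass_def dyadic_mass_def dyadic_index_1 by (rule sum.swap)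
    then show ?thesis
      using dyadic_sum_increment_le[OF col[OF that(1)] that(2,3)] by simp
  qed

  have lim: "(\<lambda>n. P n x y) \<longlonglongrightarrow> F x y" if xy: "x \<in> {0..1}" "y \<in> {0..1}" for x y
  proof -
    have inc: "incseq (\<lambda>n. P n x y)"
      unfolding P_def by (intro incseq_SucI positive_mass_Suc)
    have "P n x y \<le> K" for n
    proof -
      \<comment> \<open>The bound is available from level 1 on, and passing to a finer level only increases the mass.\<close>
      have "P n x y \<le> P (Suc n) x y" using inc by (simp add: incseq_Suc_iff)
      also have "\<dots> \<le> P (Suc n) x 1"
        using two_increasingD[OF P2, of 0 x y 1 "Suc n"] xy by (simp add: volume_def P0)
      also have "\<dots> \<le> P (Suc n) 1 1"
        using two_increasingD[OF P2, of x 1 0 1 "Suc n"] xy by (simp add: volume_def P0)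
      also have "\<dots> \<le> K"
        using incr1[of "Suc n" 0 1] by (simp add: P0)
      finally show ?thesis .
    qed
    with inc obtain L where "(\<lambda>n. P n x y) \<longlonglongrightarrow> L"
      using incseq_convergent[of "\<lambda>n. P n x y" K] by metis
    then have "convergent (\<lambda>n. P n x y)" by (rule convergentI)
    then show ?thesis unfolding F_def by (simp add: convergent_LIMSEQ_iff)
  qed

  \<comment> \<open>\<open>P n\<close> minus the sum of all volumes of level \<open>n\<close> is the sum of their negative parts.\<close>
  have neg: "two_increasing
      (\<lambda>x y. P n x y - Q (real (dyadic_index n x) / 2 ^ n) (real (dyadic_index n y) / 2 ^ n))"
    (is "two_increasing (?N n)") for n
  \<comment> \<open>The equality holds only on the unit square, so it is applied as the limit of a constant sequence.\<close>
  proof (rule two_increasing_limit)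
    show "two_increasing (dyadic_mass (\<lambda>i j. max (- dyadic_volume Q n i j) 0) n)" for m :: nat
      by (rule two_increasing_dyadic_mass) simp
    fix x y :: real assume xy: "x \<in> {0..1}" "y \<in> {0..1}"
    have minus: "max (- v) 0 = max v 0 - v" for v :: real by simp
    have "dyadic_mass (\<lambda>i j. max (- dyadic_volume Q n i j) 0) n x y =
            P n x y - (\<Sum>i=1..dyadic_index n x. \<Sum>j=1..dyadic_index n y. dyadic_volume Q n i j)"
      unfolding minus by (simp add: P_def positive_mass_def dyadic_mass_def sum_subtractf)
    also have "(\<Sum>i=1..dyadic_index n x. \<Sum>j=1..dyadic_index n y. dyadic_volume Q n i j) =
        Q (real (dyadic_index n x) / 2 ^ n) (real (dyadic_index n y) / 2 ^ n)"
      using Q xy by (intro sum_dyadic_volume dyadic_index_le) (auto simp: quasi_copula_def)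
    finally show "(\<lambda>m. dyadic_mass (\<lambda>i j. max (- dyadic_volume Q n i j) 0) n x y) \<longlonglongrightarrow> ?N n x y"
      by simp
  qed

  show ?thesis
  proof (rule that)
    show "two_increasing F" using P2 lim by (rule two_increasing_limit)
    show "two_increasing (\<lambda>x y. F x y - Q x y)"
      by (rule two_increasing_limit[where F = ?N, OF neg])
        (intro tendsto_intros lim quasi_copula_dyadic_index_tendsto[OF Q])
    show "F x 0 = 0" "F 0 x = 0" for x by (simp_all add: F_def P0)
    have idx: "(\<lambda>n. K * (real (dyadic_index n t) / 2 ^ n - real (dyadic_index n s) / 2 ^ n))
                 \<longlonglongrightarrow> K * (t - s)" if "0 \<le> s" "s \<le> t" for s t
      using that by (intro tendsto_intros dyadic_index_tendsto) auto
    have "F x2 1 - F x1 1 \<le> K * (x2 - x1)" if "0 \<le> x1" "x1 \<le> x2" "x2 \<le> 1" for x1 x2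
    proof (rule LIMSEQ_le[OF _ idx])
      show "(\<lambda>n. P n x2 1 - P n x1 1) \<longlonglongrightarrow> F x2 1 - F x1 1"
        using that by (intro tendsto_intros lim) auto
    qed (use incr1 that in auto)
    then show "mono_on {0..1} (\<lambda>x. K * x - F x 1)"
      by (intro mono_onI) (simp add: algebra_simps)
    have "F 1 y2 - F 1 y1 \<le> K * (y2 - y1)" if "0 \<le> y1" "y1 \<le> y2" "y2 \<le> 1" for y1 y2
    proof (rule LIMSEQ_le[OF _ idx])
      show "(\<lambda>n. P n 1 y2 - P n 1 y1) \<longlonglongrightarrow> F 1 y2 - F 1 y1"
        using that by (intro tendsto_intros lim) auto
    qed (use incr2 that in auto)
    then show "mono_on {0..1} (\<lambda>y. K * y - F 1 y)"
      by (intro mono_onI) (simp add: algebra_simps)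
  qed
qed

section \<open>Making the margins uniform\<close>

text \<open>
  The function \<open>H\<close> below is the product of the two margin defects, divided by their common value
  at \<open>1\<close>, which gives it exactly these defects as its margins. Adding it to \<open>F\<close> and to \<open>F - Q\<close>
  does not change their difference.
\<close>

lemma difference_if_alpha_finite:
  assumes Q: "quasi_copula Q" and fin: "alpha Q < \<infinity>"
  shows "scaled_copula_difference Q"
proof -
  obtain F K where F: "two_increasing F" "two_increasing (\<lambda>x y. F x y - Q x y)"
    and F0: "\<And>x. F x 0 = 0" "\<And>y. F 0 y = 0"
    and defect: "mono_on {0..1} (\<lambda>x. K * x - F x 1)" "mono_on {0..1} (\<lambda>y. K * y - F 1 y)"
    by (rule quasi_copula_positive_part[OF Q fin]) (rule that)
  \<comment> \<open>A slope strictly above \<open>K\<close>, so that the defects do not vanish at \<open>1\<close>.\<close>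
  define c where "c = K + 1"
  define d where "d = c - F 1 1"
  have "0 < d" using mono_onD[OF defect(1), of 0 1] F0 by (simp add: d_def c_def)
  define f where "f x = (c * x - F x 1) / d" for x
  define g where "g y = c * y - F 1 y" for y
  define H where "H x y = f x * g y" for x y
  have "c * s - F s 1 \<le> c * t - F t 1" "g s \<le> g t" if "0 \<le> s" "s \<le> t" "t \<le> 1" for s t
    using mono_onD[OF defect(1), of s t] mono_onD[OF defect(2), of s t] that
    by (simp_all add: g_def c_def algebra_simps)
  then have "mono_on {0..1} f" "mono_on {0..1} g"
    using \<open>0 < d\<close> unfolding f_def by (auto intro!: mono_onI divide_right_mono)
  then have H2: "two_increasing H" unfolding H_def by (rule two_increasing_product_form)
  have margins: "H x 0 = 0" "H 0 y = 0" "H x 1 = c * x - F x 1" "H 1 y = c * y - F 1 y" for x y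
  proof -
    have "F 1 1 = c - d" "f 1 = 1" using \<open>0 < d\<close> by (simp_all add: f_def d_def)
    then show "H x 0 = 0" "H 0 y = 0" "H x 1 = c * x - F x 1" "H 1 y = c * y - F 1 y"
      using \<open>0 < d\<close> F0 by (simp_all add: H_def f_def g_def)
  qed
  show ?thesis
  proof (rule scaled_copula_differenceI)
    show "scaled_copula c (\<lambda>x y. F x y + H x y)"
      using two_increasing_add[OF F(1) H2] F0 margins by (simp add: scaled_copula_def)
    show "scaled_copula (c - 1) (\<lambda>x y. F x y - Q x y + H x y)"
      using two_increasing_add[OF F(2) H2] F0 margins Q
      by (simp add: scaled_copula_def quasi_copula_def algebra_simps)
  qed simp
qed

theorem theorem10:
  fixes Q :: "real \<Rightarrow> real \<Rightarrow> real"
  assumes "quasi_copula Q"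
  shows "(copula_series Q \<longleftrightarrow> in_copula_span Q) \<and>
         (in_copula_span Q \<longleftrightarrow> two_copula_combination Q) \<and>
         (two_copula_combination Q \<longleftrightarrow> alpha Q < \<infinity>)"
proof -
  have "two_copula_combination Q" if "copula_series Q \<or> in_copula_span Q \<or> alpha Q < \<infinity>"
    using that two_copula_combination_if_difference difference_if_copula_series
      difference_if_in_copula_span difference_if_alpha_finite[OF assms] by blast
  then show ?thesis
    using copula_series_if_two in_copula_span_if_two alpha_finite_if_two by blast
qed

end
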